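(* Let $G$ be a topological group with identity element $e_G$. Then $G$ is a strong small loop transfer (strong SLT) space at $e_G$.
   Context: Paths are continuous maps $I=[0,1]\to X$; $\alpha*\beta$ denotes concatenation of paths, $\bar\alpha(t)=\alpha(1-t)$ is the reversed path, and $\dot I=\{0,1\}$. A topological space $X$ is called a strong small loop transfer (strong SLT) space at $x_0\in X$ if for every $x\in X$ and every open neighborhood $U$ of $x_0$ there is an open neighborhood $V$ of $x$ such that for every path $\alpha$ in $X$ with $\alpha(0)=x_0$, $\alpha(1)=x$ and every loop $\beta$ in $V$ based at $x$ there is a loop $\gamma$ in $U$ based at $x_0$ which is homotopic (in $X$) to $\alpha*\beta*\bar\alpha$ relative to $\dot I$. *)

theory Defs
  imports "HOL-Analysis.Analysis"
begin

text \<open>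
  The space is a subset \<open>S\<close> of an ambient topological space, with the subspace topology;
  a whole type is the case \<open>S = UNIV\<close>. Bracketing of the triple concatenation is immaterial up to
  homotopy relative to the end points; \<open>+++\<close> associates to the right. A loop in \<open>V\<close> based
  at \<open>x\<close> is a path with image in \<open>V\<close> whose end points are both \<open>x\<close>. The homotopy is taken in
  all of \<open>S\<close>.
\<close>

definition strong_slt_space_at :: "'a::topological_space set \<Rightarrow> 'a \<Rightarrow> bool" where
  "strong_slt_space_at S x0 \<longleftrightarrow>
     x0 \<in> S \<and>
     (\<forall>x\<in>S. \<forall>U. openin (top_of_set S) U \<and> x0 \<in> U \<longrightarrow>
       (\<exists>V. openin (top_of_set S) V \<and> x \<in> V \<and>
         (\<forall>\<alpha> \<beta>.
            path \<alpha> \<and> path_image \<alpha> \<subseteq> S \<and> pathstart \<alpha> = x0 \<and> pathfinish \<alpha> = x \<and>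
            path \<beta> \<and> path_image \<beta> \<subseteq> V \<and> pathstart \<beta> = x \<and> pathfinish \<beta> = x \<longrightarrow>
            (\<exists>\<gamma>. path \<gamma> \<and> path_image \<gamma> \<subseteq> U \<and> pathstart \<gamma> = x0 \<and> pathfinish \<gamma> = x0 \<and>
                 homotopic_paths S \<gamma> (\<alpha> +++ \<beta> +++ reversepath \<alpha>)))))"

text \<open>
  The class \<open>topological_group_add\<close> is that of arbitrary topological groups in additive
  notation: neither commutativity nor a separation axiom is assumed, and \<open>0\<close> is the identity.
\<close>

end

theory Submission
  imports Defs
begin

text \<open>
  Translating a loop \<open>\<beta>\<close> at \<open>x\<close> back to the identity gives a loop \<open>\<gamma> t = \<beta> t - x\<close> at \<open>0\<close>, and
  continuity of the translation provides, for any neighbourhood \<open>U\<close> of \<open>0\<close>, the neighbourhood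
  \<open>V = {y. y - x \<in> U}\<close> of \<open>x\<close> whose loops are carried into \<open>U\<close>. Nothing here depends on
  the path \<open>\<alpha>\<close> from \<open>0\<close> to \<open>x\<close>; this is the uniformity that distinguishes the strong form of
  small loop transfer.

  That \<open>\<gamma>\<close> is homotopic to the conjugate \<open>\<alpha> +++ \<beta> +++ reversepath \<alpha>\<close> is an Eckmann--Hilton
  argument. Let \<open>\<alpha>'\<close> run along \<open>\<alpha>\<close>, wait at \<open>x\<close>, and return along \<open>\<alpha>\<close>, and let \<open>\<gamma>'\<close> run
  through \<open>\<gamma>\<close> while \<open>\<alpha>'\<close> waits and stay at \<open>0\<close> otherwise. Since \<open>0\<close> is neutral and
  \<open>\<beta> = \<gamma> + x\<close>, the conjugate is the pointwise sum \<open>\<gamma>' + \<alpha>'\<close>. Now \<open>\<gamma>'\<close> is a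
  reparametrization of \<open>\<gamma>\<close> and \<open>\<alpha>'\<close> is homotopic to the constant path \<open>0\<close>. Homotopies can
  be added pointwise (\<open>homotopic_paths_add\<close>), so the conjugate is homotopic to
  \<open>\<gamma> + 0 = \<gamma>\<close> (\<open>homotopic_paths_conjugate_translate\<close>).
\<close>

lemma homotopic_paths_add:
  fixes p q p' q' :: "real \<Rightarrow> 'a::topological_monoid_add"
  assumes "homotopic_paths UNIV p p'" and "homotopic_paths UNIV q q'"
  shows "homotopic_paths UNIV (\<lambda>t. p t + q t) (\<lambda>t. p' t + q' t)"
proof -
  obtain h :: "real \<times> real \<Rightarrow> 'a" where h: "continuous_on ({0..1} \<times> {0..1}) h"
      "\<forall>t\<in>{0..1}. h (0, t) = p t" "\<forall>t\<in>{0..1}. h (1, t) = p' t"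
      "\<forall>s\<in>{0..1}. pathstart (h \<circ> Pair s) = pathstart p \<and> pathfinish (h \<circ> Pair s) = pathfinish p"
    using assms(1) unfolding homotopic_paths by blast
  obtain k :: "real \<times> real \<Rightarrow> 'a" where k: "continuous_on ({0..1} \<times> {0..1}) k"
      "\<forall>t\<in>{0..1}. k (0, t) = q t" "\<forall>t\<in>{0..1}. k (1, t) = q' t"
      "\<forall>s\<in>{0..1}. pathstart (k \<circ> Pair s) = pathstart q \<and> pathfinish (k \<circ> Pair s) = pathfinish q"
    using assms(2) unfolding homotopic_paths by blast
  show ?thesis
    unfolding homotopic_paths
    by (rule exI[of _ "\<lambda>z. h z + k z"])
      (use h k in \<open>auto simp: pathstart_def pathfinish_def intro!: continuous_on_add\<close>)
qed

text \<open>
  The unit interval is convex, so \<open>u\<close> and \<open>v\<close> are joined by a straight-line homotopy, and \<open>p\<close>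
  carries it into the space. With \<open>u 0 = 0\<close> and \<open>u 1 = 1\<close> this is invariance under
  reparametrization; with \<open>u 0 = u 1\<close> it contracts a path that goes back and forth along \<open>p\<close>.
\<close>

lemma homotopic_paths_compose_unit_interval:
  fixes p :: "real \<Rightarrow> 'a::topological_space"
  assumes p: "path p" and uv: "path u" "path v"
    and im: "path_image u \<subseteq> {0..1}" "path_image v \<subseteq> {0..1}"
    and ends: "pathstart u = pathstart v" "pathfinish u = pathfinish v"
  shows "homotopic_paths UNIV (p \<circ> u) (p \<circ> v)"
proof (rule homotopic_paths_continuous_image)
  show "homotopic_paths {0..1} u v"
  proof (rule homotopic_paths_linear[OF uv])
    fix t :: real
    assume "t \<in> {0..1}"
    then have "u t \<in> {0..1}" "v t \<in> {0..1}"
      using im unfolding path_image_def by blast+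
    then show "closed_segment (u t) (v t) \<subseteq> {0..1}"
      by (intro closed_segment_subset convex_real_interval)
  qed (use ends in auto)
  show "continuous_on {0..1} p"
    using p by (simp add: path_def)
qed auto

text \<open>
  The translates \<open>\<lambda>t. \<gamma> t + \<alpha> s\<close> move \<open>\<gamma>\<close> to \<open>\<lambda>t. \<gamma> t + x\<close> through loops whose base point
  runs along \<open>\<alpha>\<close>; hence conjugating the translate by \<open>\<alpha>\<close> undoes the translation.
\<close>

lemma homotopic_paths_conjugate_translate:
  fixes \<alpha> \<gamma> :: "real \<Rightarrow> 'a::topological_monoid_add"
  assumes \<alpha>: "path \<alpha>" "pathstart \<alpha> = 0" "pathfinish \<alpha> = x"
    and \<gamma>: "path \<gamma>" "pathstart \<gamma> = 0" "pathfinish \<gamma> = 0"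
  shows "homotopic_paths UNIV \<gamma> (\<alpha> +++ (\<lambda>t. \<gamma> t + x) +++ reversepath \<alpha>)"
proof -
  \<comment> \<open>As \<open>+++\<close> associates to the right, the three pieces occupy \<open>[0, 1/2]\<close>, \<open>[1/2, 3/4]\<close> and
    \<open>[3/4, 1]\<close>. The clock \<open>f\<close> of \<open>\<gamma>\<close> advances only on the middle piece, and the clock \<open>g\<close>
    of \<open>\<alpha>\<close> rises on the first, rests at 1 on the middle and falls on the last.\<close>
  define f :: "real \<Rightarrow> real" where "f t = max 0 (min 1 (4 * t - 2))" for t
  define g :: "real \<Rightarrow> real" where "g t = min 1 (min (2 * t) (4 - 4 * t))" for t
  have "homotopic_paths UNIV (\<gamma> \<circ> id) (\<gamma> \<circ> f)"
    by (rule homotopic_paths_compose_unit_interval[OF \<gamma>(1)])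
      (auto simp: f_def path_def path_image_def pathstart_def pathfinish_def
        intro!: continuous_intros)
  moreover have "homotopic_paths UNIV (\<alpha> \<circ> (\<lambda>_. 0)) (\<alpha> \<circ> g)"
    by (rule homotopic_paths_compose_unit_interval[OF \<alpha>(1)])
      (auto simp: g_def path_def path_image_def pathstart_def pathfinish_def
        intro!: continuous_intros)
  ultimately have sum:
    "homotopic_paths UNIV (\<lambda>t. (\<gamma> \<circ> id) t + (\<alpha> \<circ> (\<lambda>_. 0)) t) (\<lambda>t. (\<gamma> \<circ> f) t + (\<alpha> \<circ> g) t)"
    by (rule homotopic_paths_add)
  have ends: "\<alpha> 0 = 0" "\<alpha> 1 = x" "\<gamma> 0 = 0" "\<gamma> 1 = 0"
    using \<alpha> \<gamma> by (simp_all add: pathstart_def pathfinish_def)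
  have conj: "(\<gamma> \<circ> f) t + (\<alpha> \<circ> g) t = (\<alpha> +++ (\<lambda>t. \<gamma> t + x) +++ reversepath \<alpha>) t"
    if "t \<in> {0..1}" for t
  proof -
    consider "t \<le> 1/2" | "1/2 < t" "t \<le> 3/4" | "3/4 < t"
      by linarith
    then show ?thesis
    proof cases
      case 1
      then have "f t = 0" "g t = 2 * t"
        by (auto simp: f_def g_def)
      with 1 show ?thesis
        by (simp add: joinpaths_def ends)
    next
      case 2
      then have "f t = 2 * (2 * t - 1)" "g t = 1"
        by (auto simp: f_def g_def)
      with 2 show ?thesis
        by (simp add: joinpaths_def ends)
    next
      case 3
      then have "f t = 1" "g t = 1 - (2 * (2 * t - 1) - 1)"
        by (auto simp: f_def g_def)
      with 3 show ?thesis
        by (simp add: joinpaths_def reversepath_def ends)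
    qed
  qed
  have "homotopic_paths UNIV (\<lambda>t. (\<gamma> \<circ> f) t + (\<alpha> \<circ> g) t)
      (\<alpha> +++ (\<lambda>t. \<gamma> t + x) +++ reversepath \<alpha>)"
    using homotopic_paths_imp_path[OF sum] conj by (intro homotopic_paths_eq) auto
  with sum have "homotopic_paths UNIV (\<lambda>t. (\<gamma> \<circ> id) t + (\<alpha> \<circ> (\<lambda>_. 0)) t)
      (\<alpha> +++ (\<lambda>t. \<gamma> t + x) +++ reversepath \<alpha>)"
    by (rule homotopic_paths_trans)
  then show ?thesis
    by (simp add: ends)
qed

theorem theorem2p4:
  shows "strong_slt_space_at (UNIV :: 'a::topological_group_add set) 0"
  unfolding strong_slt_space_at_def
proof (intro conjI ballI allI impI)
  fix x :: 'a and U :: "'a set"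
  assume "openin (top_of_set UNIV) U \<and> 0 \<in> U"
  then have U: "open U" "0 \<in> U"
    by simp_all
  let ?V = "(\<lambda>y. y - x) -` U"
  show "\<exists>V. openin (top_of_set UNIV) V \<and> x \<in> V \<and>
         (\<forall>\<alpha> \<beta>.
            path \<alpha> \<and> path_image \<alpha> \<subseteq> UNIV \<and> pathstart \<alpha> = 0 \<and> pathfinish \<alpha> = x \<and>
            path \<beta> \<and> path_image \<beta> \<subseteq> V \<and> pathstart \<beta> = x \<and> pathfinish \<beta> = x \<longrightarrow>
            (\<exists>\<gamma>. path \<gamma> \<and> path_image \<gamma> \<subseteq> U \<and> pathstart \<gamma> = 0 \<and> pathfinish \<gamma> = 0 \<and>
                 homotopic_paths UNIV \<gamma> (\<alpha> +++ \<beta> +++ reversepath \<alpha>)))"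
  proof (intro exI[of _ ?V] conjI allI impI)
    have "open ?V"
      using U(1) by (intro open_vimage continuous_intros)
    then show "openin (top_of_set UNIV) ?V"
      by simp
    show "x \<in> ?V"
      using U(2) by simp
    fix \<alpha> \<beta> :: "real \<Rightarrow> 'a"
    assume *: "path \<alpha> \<and> path_image \<alpha> \<subseteq> UNIV \<and> pathstart \<alpha> = 0 \<and> pathfinish \<alpha> = x \<and>
      path \<beta> \<and> path_image \<beta> \<subseteq> ?V \<and> pathstart \<beta> = x \<and> pathfinish \<beta> = x"
    define \<gamma> where "\<gamma> t = \<beta> t - x" for t
    have \<gamma>: "path \<gamma>" "pathstart \<gamma> = 0" "pathfinish \<gamma> = 0"
      using * by (auto simp: \<gamma>_def path_def pathstart_def pathfinish_def intro!: continuous_intros)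
    have "path_image \<gamma> \<subseteq> U"
      using * by (auto simp: \<gamma>_def path_image_def)
    moreover have "homotopic_paths UNIV \<gamma> (\<alpha> +++ (\<lambda>t. \<gamma> t + x) +++ reversepath \<alpha>)"
      using * \<gamma> by (intro homotopic_paths_conjugate_translate) auto
    moreover have "(\<lambda>t. \<gamma> t + x) = \<beta>"
      by (simp add: \<gamma>_def)
    ultimately show "\<exists>\<gamma>. path \<gamma> \<and> path_image \<gamma> \<subseteq> U \<and> pathstart \<gamma> = 0 \<and> pathfinish \<gamma> = 0 \<and>
        homotopic_paths UNIV \<gamma> (\<alpha> +++ \<beta> +++ reversepath \<alpha>)"
      using \<gamma> by auto
  qed
qed simp

end
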